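(* Let $A$ be the single-scale operator $$Af(x)=\int_{\mathbb{R}}f(x_1-t,x_2-t^2)\,\varphi(t)\,dt .$$ Then, for every $0<p<1$, $A$ is not bounded from $H^p_{\mathrm{par}}(\mathbb{R}^2)$ to $L^{p,\infty}(\mathbb{R}^2)$; that is, there is no finite constant $C$ such that $\|Af\|_{L^{p,\infty}(\mathbb{R}^2)}\le C\|f\|_{H^p_{\mathrm{par}}(\mathbb{R}^2)}$ for all $f\in H^p_{\mathrm{par}}(\mathbb{R}^2)$.
   Context: Here $\varphi$ is a fixed nonnegative smooth bump function on $\mathbb{R}$ with $\varphi\le 1$, $\varphi\equiv 1$ on $(1,2)$ and $\operatorname{supp}\varphi\subseteq(1/2,5/2)$. For $f\in L^1_{\mathrm{loc}}(\mathbb{R}^2)$, $Af$ is understood for almost every $x=(x_1,x_2)\in\mathbb{R}^2$. A parabolic box is a set $Q=Q(z,\rho)=z+[-\rho,\rho]\times[-\rho^2,\rho^2]$ with $z\in\mathbb{R}^2$, $\rho>0$; its side length is $\rho_Q=\rho(Q)=\rho$. For $0<p\le1$ fix a positive integer $N_p\ge\lfloor 3(1/p-1)\rfloor$. A parabolic $(p,\infty)$-atom (supported in, or associated with, $Q$) is a bounded measurable function $a$ on $\mathbb{R}^2$ for which there is a parabolic box $Q$ with $\operatorname{supp}a\subset Q$, $\|a\|_{L^\infty(\mathbb{R}^2)}\le|Q|^{-1/p}$, and $\int_{\mathbb{R}^2}x^\beta a(x)\,dx=0$ for all $\beta=(\beta_1,\beta_2)\in\mathbb{N}^2$ (with $0\in\mathbb{N}$)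 with $|\beta|=\beta_1+\beta_2\le N_p$, where $x^\beta=x_1^{\beta_1}x_2^{\beta_2}$. $H^p_{\mathrm{par}}(\mathbb{R}^2)$ is the space of all tempered distributions $f\in L^1_{\mathrm{loc}}(\mathbb{R}^2)$ admitting a (countable) representation $f=\sum_Q\lambda_Qa_Q$, converging in $L^1_{\mathrm{loc}}(\mathbb{R}^2)$, with each $a_Q$ a parabolic $(p,\infty)$-atom and $\sum_Q|\lambda_Q|^p<\infty$ (the boxes $Q$ are not required to be disjoint); $\|f\|_{H^p_{\mathrm{par}}}^p$ is the infimum of $\sum_Q|\lambda_Q|^p$ over all such representations. For measurable $f$, $\|f\|_{L^{p,\infty}(\mathbb{R}^2)}=\sup_{\alpha>0}\alpha\,|\{x\in\mathbb{R}^2:|f(x)|>\alpha\}|^{1/p}$, and $L^{p,\infty}(\mathbb{R}^2)$ is the space of measurable $f$ for which this is finite. *)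

theory Defs
  imports "HOL-Analysis.Analysis" "HOL-Probability.Essential_Supremum"
begin

text \<open>
  The plane is \<open>real \<times> real\<close> with Lebesgue measure; functions on it are complex-valued, and functions
  that agree almost everywhere are not identified.
\<close>

type_synonym plane = "real \<times> real"

definition supp :: "('a::topological_space \<Rightarrow> 'b::zero) \<Rightarrow> 'a set" where
  "supp f = closure {x. f x \<noteq> 0}"

definition bump :: "(real \<Rightarrow> real) \<Rightarrow> bool" where
  "bump \<phi> \<longleftrightarrow>
     (\<forall>n. ((deriv ^^ n) \<phi>) differentiable_on UNIV) \<and>
     (\<forall>t. 0 \<le> \<phi> t \<and> \<phi> t \<le> 1) \<and>
     (\<forall>t\<in>{1<..<2}. \<phi> t = 1) \<and>
     supp \<phi> \<subseteq> {1/2<..<5/2}"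

text \<open>
  For locally integrable \<open>f\<close> the integrand is integrable for almost every \<open>x\<close>; on the exceptional
  null set the value is irrelevant.
\<close>

definition avg_op :: "(real \<Rightarrow> real) \<Rightarrow> (plane \<Rightarrow> complex) \<Rightarrow> plane \<Rightarrow> complex" where
  "avg_op \<phi> f x = (LINT t|lebesgue. f (fst x - t, snd x - t\<^sup>2) * complex_of_real (\<phi> t))"


subsection \<open>Local integrability and tempered distributions\<close>

definition L1loc :: "(plane \<Rightarrow> complex) set" where
  "L1loc = {f. f \<in> borel_measurable lebesgue \<and> (\<forall>K. compact K \<longrightarrow> set_integrable lebesgue K f)}"

definition tendsto_L1loc :: "(nat \<Rightarrow> plane \<Rightarrow> complex) \<Rightarrow> (plane \<Rightarrow> complex) \<Rightarrow> bool" where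
  "tendsto_L1loc F f \<longleftrightarrow>
     (\<forall>K. compact K \<longrightarrow> (\<lambda>n. LINT x:K|lebesgue. norm (F n x - f x)) \<longlonglongrightarrow> 0)"

definition pderiv_dir :: "plane \<Rightarrow> (plane \<Rightarrow> complex) \<Rightarrow> plane \<Rightarrow> complex" where
  "pderiv_dir e \<psi> = (\<lambda>x. frechet_derivative \<psi> (at x) e)"

definition pderivs :: "nat \<Rightarrow> nat \<Rightarrow> (plane \<Rightarrow> complex) \<Rightarrow> plane \<Rightarrow> complex" where
  "pderivs i j \<psi> = (pderiv_dir (1, 0) ^^ i) ((pderiv_dir (0, 1) ^^ j) \<psi>)"

text \<open>
  Fixing the order of differentiation loses nothing: all the iterated derivatives are required to be
  (totally) differentiable, so mixed partial derivatives commute.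
\<close>

definition smooth_plane :: "(plane \<Rightarrow> complex) \<Rightarrow> bool" where
  "smooth_plane \<psi> \<longleftrightarrow> (\<forall>i j. pderivs i j \<psi> differentiable_on UNIV)"

definition test_functions :: "(plane \<Rightarrow> complex) set" where
  "test_functions = {\<psi>. smooth_plane \<psi> \<and> compact (supp \<psi>)}"

definition schwartz_term :: "nat \<Rightarrow> nat \<Rightarrow> nat \<Rightarrow> nat \<Rightarrow> (plane \<Rightarrow> complex) \<Rightarrow> plane \<Rightarrow> real" where
  "schwartz_term k l i j \<psi> x = \<bar>fst x ^ k * snd x ^ l\<bar> * norm (pderivs i j \<psi> x)"

definition schwartz_space :: "(plane \<Rightarrow> complex) set" where
  "schwartz_space =
     {\<psi>. smooth_plane \<psi> \<and> (\<forall>k l i j. bdd_above (range (schwartz_term k l i j \<psi>)))}"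

text \<open>Only the values of \<open>T\<close> on the Schwartz space are meaningful.\<close>

definition tempered_distribution :: "((plane \<Rightarrow> complex) \<Rightarrow> complex) \<Rightarrow> bool" where
  "tempered_distribution T \<longleftrightarrow>
     (\<forall>\<psi>\<in>schwartz_space. \<forall>\<eta>\<in>schwartz_space. \<forall>c d.
        T (\<lambda>x. c * \<psi> x + d * \<eta> x) = c * T \<psi> + d * T \<eta>) \<and>
     (\<exists>C M. \<forall>\<psi>\<in>schwartz_space.
        norm (T \<psi>) \<le> C * (\<Sum>k\<le>M. \<Sum>l\<le>M. \<Sum>i\<le>M. \<Sum>j\<le>M. SUP x. schwartz_term k l i j \<psi> x))"

text \<open>
  A locally integrable function is a tempered distribution if the distribution it induces on
  test functions extends to one.
\<close>

definition is_tempered :: "(plane \<Rightarrow> complex) \<Rightarrow> bool" where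
  "is_tempered f \<longleftrightarrow>
     (\<exists>T. tempered_distribution T \<and> (\<forall>\<psi>\<in>test_functions. T \<psi> = (LINT x|lebesgue. f x * \<psi> x)))"


subsection \<open>Parabolic atoms and the parabolic Hardy space\<close>

definition pbox :: "plane \<Rightarrow> real \<Rightarrow> plane set" where
  "pbox z \<rho> = (\<lambda>w. z + w) ` ({-\<rho>..\<rho>} \<times> {-(\<rho>\<^sup>2)..\<rho>\<^sup>2})"

text \<open>\<open>N\<close> is the order up to which moments vanish.\<close>

definition patom :: "nat \<Rightarrow> real \<Rightarrow> (plane \<Rightarrow> complex) \<Rightarrow> bool" where
  "patom N p a \<longleftrightarrow>
     a \<in> borel_measurable lebesgue \<and> bounded (range a) \<and>
     (\<exists>z \<rho>. \<rho> > 0 \<and> supp a \<subseteq> pbox z \<rho> \<and>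
        esssup lebesgue (\<lambda>x. ereal (norm (a x))) \<le> ereal (measure lebesgue (pbox z \<rho>) powr (-1/p))) \<and>
     (\<forall>i j. i + j \<le> N \<longrightarrow>
        (LINT x|lebesgue. complex_of_real (fst x ^ i * snd x ^ j) * a x) = 0)"

text \<open>
  Countable representations are indexed by \<open>nat\<close>. Finite ones are included by padding with zero
  coefficients.
\<close>

definition atomic_rep ::
  "nat \<Rightarrow> real \<Rightarrow> (plane \<Rightarrow> complex) \<Rightarrow> (nat \<Rightarrow> complex) \<Rightarrow> (nat \<Rightarrow> plane \<Rightarrow> complex) \<Rightarrow> bool" where
  "atomic_rep N p f c a \<longleftrightarrow>
     (\<forall>n. patom N p (a n)) \<and>
     summable (\<lambda>n. norm (c n) powr p) \<and>
     tendsto_L1loc (\<lambda>n x. \<Sum>k<n. c k * a k x) f"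

definition Hpar :: "nat \<Rightarrow> real \<Rightarrow> (plane \<Rightarrow> complex) set" where
  "Hpar N p = {f \<in> L1loc. is_tempered f \<and> (\<exists>c a. atomic_rep N p f c a)}"

definition Hpar_norm :: "nat \<Rightarrow> real \<Rightarrow> (plane \<Rightarrow> complex) \<Rightarrow> real" where
  "Hpar_norm N p f =
     (Inf {(\<Sum>n. norm (c n) powr p) | c a. atomic_rep N p f c a}) powr (1/p)"


subsection \<open>Weak Lebesgue quasinorm\<close>

text \<open>Powers of extended nonnegative reals with exponent \<open>s > 0\<close>.\<close>

definition ennreal_powr :: "ennreal \<Rightarrow> real \<Rightarrow> ennreal" where
  "ennreal_powr y s = (if y = \<infinity> then \<infinity> else ennreal (enn2real y powr s))"

definition weak_Lp_norm :: "real \<Rightarrow> (plane \<Rightarrow> complex) \<Rightarrow> ennreal" where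
  "weak_Lp_norm p g =
     (SUP \<alpha>\<in>{0<..}. ennreal \<alpha> * ennreal_powr (emeasure lebesgue {x. norm (g x) > \<alpha>}) (1/p))"

end

theory Submission
  imports Defs
begin

text \<open>
  A single atom at scale \<open>\<delta>\<close> suffices: the parabola \<open>(t, t\<^sup>2)\<close>, \<open>1 < t < 2\<close>, crosses the boxes
  transversally. An iterated horizontal difference of the indicator of
  \<open>[0, \<delta>) \<times> [-\<delta>\<^sup>2, \<delta>\<^sup>2]\<close> has vanishing moments, and normalised to an atom it has height about
  \<open>\<delta> powr (-3/p)\<close>. Its average is at least a multiple of \<open>\<delta> powr (2 - 3/p)\<close> on a strip of width
  about \<open>\<delta>\<close>, since the curve spends time about \<open>\<delta>\<^sup>2\<close> in a translate of the cell without meeting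
  a neighbouring one. So the weak quasinorm is at least a multiple of \<open>\<delta> powr (2 - 2/p)\<close>, which is
  unbounded as \<open>\<delta>\<close> tends to 0.
\<close>

section \<open>Integrability and translation invariance\<close>

text \<open>\<open>B * norm (h x)\<close> on the compact \<open>K\<close> dominates the product. A
  general continuous \<open>h\<close> covers both the monomials of the moment conditions and the
  Schwartz functions of the temperedness proof.\<close>

lemma integrable_continuous_mult_bounded_support:
  fixes g h :: "'a::euclidean_space \<Rightarrow> complex"
  assumes [measurable]: "g \<in> borel_measurable borel" and h: "continuous_on UNIV h"
    and B: "\<And>x. norm (g x) \<le> B" and K: "compact K" and 0: "\<And>x. x \<notin> K \<Longrightarrow> g x = 0"
  shows "integrable lborel (\<lambda>x. h x * g x)"
proof (rule Bochner_Integration.integrable_bound)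
  show "integrable lborel (\<lambda>x. B *\<^sub>R (indicator K x *\<^sub>R h x))"
    by (rule integrable_scaleR_right) (rule borel_integrable_compact[OF K continuous_on_subset[OF h subset_UNIV]])
  have [measurable]: "h \<in> borel_measurable borel"
    using h by (rule borel_measurable_continuous_onI)
  show "(\<lambda>x. h x * g x) \<in> borel_measurable lborel"
    by measurable
  have "0 \<le> B"
    using B[of 0] norm_ge_zero order_trans by blast
  then show "AE x in lborel. norm (h x * g x) \<le> norm (B *\<^sub>R (indicator K x *\<^sub>R h x))"
    using B 0 by (intro AE_I2) (auto simp: norm_mult indicator_def mult.commute intro: mult_right_mono)
qed

lemma
  fixes f :: "'a::euclidean_space \<Rightarrow> 'b::{banach, second_countable_topology}"
  assumes [measurable]: "f \<in> borel_measurable borel"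
  shows integral_lborel_translation: "(LINT x|lborel. f (x - c)) = (LINT x|lborel. f x)"
    and integrable_lborel_translation: "integrable lborel (\<lambda>x. f (x - c)) = integrable lborel f"
proof -
  have "(LINT x|lborel. f x) = (LINT x|distr lborel borel ((+) (- c)). f x)"
    by (simp add: lborel_distr_plus)
  also have "\<dots> = (LINT x|lborel. f (x - c))"
    by (subst integral_distr) auto
  finally show "(LINT x|lborel. f (x - c)) = (LINT x|lborel. f x)" ..
  have "integrable lborel f = integrable (distr lborel borel ((+) (- c))) f"
    by (simp add: lborel_distr_plus)
  also have "\<dots> = integrable lborel (\<lambda>x. f (x - c))"
    by (subst integrable_distr_eq) auto
  finally show "integrable lborel (\<lambda>x. f (x - c)) = integrable lborel f" ..
qed

section \<open>Iterated horizontal differences of a cell\<close>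

text \<open>Unfolded, this is the sum over k \<le> n of (-1)^k binomial(n, k) times the indicator of
  the cell moved right by k\<delta>. The half-open side makes these translates disjoint.\<close>

primrec cell_diff :: "real \<Rightarrow> nat \<Rightarrow> plane \<Rightarrow> real" where
  "cell_diff \<delta> 0 x = indicator ({0..<\<delta>} \<times> {-(\<delta>\<^sup>2)..\<delta>\<^sup>2}) x"
| "cell_diff \<delta> (Suc n) x = cell_diff \<delta> n x - cell_diff \<delta> n (x - (\<delta>, 0))"

lemma borel_measurable_cell_diff [measurable]: "cell_diff \<delta> n \<in> borel_measurable borel"
proof (induction n)
  case 0
  have "{0..<\<delta>} \<times> {-(\<delta>\<^sup>2)..\<delta>\<^sup>2} \<in> sets (borel :: plane measure)"
    unfolding borel_prod[symmetric] by (intro pair_measureI) auto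
  moreover have "cell_diff \<delta> 0 = indicator ({0..<\<delta>} \<times> {-(\<delta>\<^sup>2)..\<delta>\<^sup>2})"
    by (rule ext) simp
  ultimately show ?case
    by simp
next
  case (Suc n)
  note [measurable] = Suc.IH
  have "cell_diff \<delta> (Suc n) = (\<lambda>x. cell_diff \<delta> n x - cell_diff \<delta> n (x - (\<delta>, 0)))"
    by (rule ext) simp
  then show ?case
    by simp
qed

lemma cell_diff_eq_0:
  assumes "0 < \<delta>" "x \<notin> {0..<(real n + 1) * \<delta>} \<times> {-(\<delta>\<^sup>2)..\<delta>\<^sup>2}"
  shows "cell_diff \<delta> n x = 0"
  using assms(2)
proof (induction n arbitrary: x)
  case 0
  then show ?case by (auto simp: indicator_def)
next
  case (Suc n)
  have "x - (\<delta>, 0) \<notin> {0..<(real n + 1) * \<delta>} \<times> {-(\<delta>\<^sup>2)..\<delta>\<^sup>2}"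
    and "x \<notin> {0..<(real n + 1) * \<delta>} \<times> {-(\<delta>\<^sup>2)..\<delta>\<^sup>2}"
    using Suc.prems \<open>0 < \<delta>\<close> by (cases x; force simp: algebra_simps)+
  then show ?case
    using Suc.IH by simp
qed

text \<open>Each subtracted copy starts at first coordinate \<delta>, so no difference changes the
  value on the first cell.\<close>

lemma cell_diff_eq_1:
  assumes "0 < \<delta>" "0 \<le> fst x" "fst x < \<delta>" "\<bar>snd x\<bar> \<le> \<delta>\<^sup>2"
  shows "cell_diff \<delta> n x = 1"
proof (induction n)
  case 0
  show ?case using assms by (cases x) (auto simp: indicator_def abs_le_iff)
next
  case (Suc n)
  have "cell_diff \<delta> n (x - (\<delta>, 0)) = 0"
    using assms by (intro cell_diff_eq_0) (cases x; auto)+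
  then show ?case
    using Suc.IH by simp
qed

text \<open>Horizontal shifts keep the second coordinate, so all cells lie in one row, and off the
  row every term vanishes.\<close>

lemma cell_diff_eq_0_strip: "\<delta>\<^sup>2 < \<bar>snd x\<bar> \<Longrightarrow> cell_diff \<delta> n x = 0"
  by (induction n arbitrary: x) (auto simp: indicator_def)

lemma abs_cell_diff_le: "\<bar>cell_diff \<delta> n x\<bar> \<le> 2 ^ n"
proof (induction n arbitrary: x)
  case 0
  show ?case by (simp add: indicator_def)
next
  case (Suc n)
  show ?case
    using Suc.IH[of x] Suc.IH[of "x - (\<delta>, 0)"] by simp
qed

lemma pbox_0_eq_cbox: "pbox 0 \<rho> = cbox (-\<rho>, -(\<rho>\<^sup>2)) (\<rho>, \<rho>\<^sup>2)"
  unfolding pbox_def by (simp add: cbox_Pair_eq)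

lemma measure_pbox_0: "0 \<le> \<rho> \<Longrightarrow> measure lebesgue (pbox 0 \<rho>) = 4 * \<rho> ^ 3"
  by (simp add: pbox_0_eq_cbox content_Pair power2_eq_square power3_eq_cube)

text \<open>The row of n + 1 cells fits into a centred box of side (n + 1)\<delta>. The box is
  larger than necessary, but this costs only a factor depending on n in its measure, not a power of
  \<delta>.\<close>

lemma cell_diff_eq_0_pbox:
  assumes "0 < \<delta>" "x \<notin> pbox 0 ((real n + 1) * \<delta>)"
  shows "cell_diff \<delta> n x = 0"
proof (rule cell_diff_eq_0[OF assms(1)])
  let ?\<rho> = "(real n + 1) * \<delta>"
  have le: "\<delta>\<^sup>2 \<le> ?\<rho>\<^sup>2"
    using assms(1) by (intro power_mono) (auto simp: algebra_simps)
  show "x \<notin> {0..<?\<rho>} \<times> {-(\<delta>\<^sup>2)..\<delta>\<^sup>2}"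
  proof
    assume "x \<in> {0..<?\<rho>} \<times> {-(\<delta>\<^sup>2)..\<delta>\<^sup>2}"
    then obtain a b where ab: "x = (a, b)" "0 \<le> a" "a < ?\<rho>" "-(\<delta>\<^sup>2) \<le> b" "b \<le> \<delta>\<^sup>2"
      by auto
    then have "-(?\<rho>\<^sup>2) \<le> b" "b \<le> ?\<rho>\<^sup>2" "-?\<rho> \<le> a"
      using le by linarith+
    then show False
      using ab assms(2) by (simp add: pbox_0_eq_cbox cbox_Pair_eq)
  qed
qed

lemma integrable_mult_cell_diff:
  assumes "continuous_on UNIV h" "0 < \<delta>"
  shows "integrable lborel (\<lambda>x. h x * complex_of_real (cell_diff \<delta> n x))"
  using assms
  by (intro integrable_continuous_mult_bounded_support[where B = "2 ^ n" and K = "pbox 0 ((real n + 1) * \<delta>)"])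
    (auto simp: abs_cell_diff_le cell_diff_eq_0_pbox pbox_0_eq_cbox)

text \<open>
  Translating the monomial instead of the function, a horizontal difference lowers the
  degree of the monomial in the first variable by one.
\<close>

lemma moment_cell_diff_eq_0:
  assumes "0 < \<delta>" "i < n"
  shows "(LINT x|lborel. complex_of_real (fst x ^ i * snd x ^ j) * complex_of_real (cell_diff \<delta> n x)) = 0"
  using assms(2)
proof (induction n arbitrary: i)
  case (Suc n)
  let ?g = "\<lambda>x. complex_of_real (cell_diff \<delta> n x)"
  let ?m = "\<lambda>i x. complex_of_real (fst x ^ i * snd x ^ j)"
  \<comment> \<open>\<open>?s\<close> is the binomial expansion of
    \<open>(fst x + \<delta>) ^ i * snd x ^ j * ?g x\<close>. At \<open>x - (\<delta>, 0)\<close> it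
    becomes the original monomial times the shifted difference, so translation invariance removes
    the shift.\<close>
  let ?s = "\<lambda>x. \<Sum>k\<le>i. of_real (of_nat (i choose k) * \<delta> ^ (i - k)) * (?m k x * ?g x)"
  have int: "integrable lborel (\<lambda>x. ?m k x * ?g x)" for k
    by (rule integrable_mult_cell_diff[OF _ assms(1)]) (intro continuous_intros)
  have eq: "complex_of_real ((fst x + \<delta>) ^ i * snd x ^ j) * ?g x = ?s x" for x
    by (simp add: binomial_ring sum_distrib_right sum_distrib_left mult_ac)
  have shift: "complex_of_real (fst x ^ i * snd x ^ j) * ?g (x - (\<delta>, 0)) = ?s (x - (\<delta>, 0))" for x
    using eq[of "x - (\<delta>, 0)"] by simp
  have s_meas: "?s \<in> borel_measurable borel"
    using borel_measurable_integrable[OF int]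
    by (intro borel_measurable_sum borel_measurable_times[OF borel_measurable_const]) simp
  have s_int: "integrable lborel ?s"
    by (intro Bochner_Integration.integrable_sum integrable_mult_right int)
  have s_int': "integrable lborel (\<lambda>x. ?s (x - (\<delta>, 0)))"
    using integrable_lborel_translation[OF s_meas] s_int by (rule iffD2)
  have "(LINT x|lborel. ?m i x * complex_of_real (cell_diff \<delta> (Suc n) x))
      = (LINT x|lborel. ?m i x * ?g x - ?s (x - (\<delta>, 0)))"
    unfolding shift[symmetric] by (intro Bochner_Integration.integral_cong refl) (simp add: algebra_simps)
  also have "\<dots> = (LINT x|lborel. ?m i x * ?g x) - (LINT x|lborel. ?s (x - (\<delta>, 0)))"
    using int s_int' by (rule Bochner_Integration.integral_diff)
  also have "(LINT x|lborel. ?s (x - (\<delta>, 0))) = (LINT x|lborel. ?s x)"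
    using s_meas by (rule integral_lborel_translation)
  also have "\<dots> = (\<Sum>k\<le>i. of_real (of_nat (i choose k) * \<delta> ^ (i - k)) * (LINT x|lborel. ?m k x * ?g x))"
    by (simp add: Bochner_Integration.integral_sum integrable_mult_right int del: of_real_mult)
  \<comment> \<open>For k < i \<le> n the induction hypothesis kills the moment. The remaining term
    k = i has coefficient 1 and cancels the unshifted integral.\<close>
  also have "\<dots> = (\<Sum>k\<in>{i}. of_real (of_nat (i choose k) * \<delta> ^ (i - k)) * (LINT x|lborel. ?m k x * ?g x))"
    using Suc by (intro sum.mono_neutral_right) auto
  finally show ?case
    by simp
qed simp

section \<open>Atoms built from differences and their Hardy quasinorm\<close>

definition cell_atom :: "real \<Rightarrow> real \<Rightarrow> nat \<Rightarrow> plane \<Rightarrow> complex" where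
  "cell_atom M \<delta> n x = complex_of_real (M * cell_diff \<delta> n x)"

lemma borel_measurable_cell_atom [measurable]: "cell_atom M \<delta> n \<in> borel_measurable borel"
  unfolding cell_atom_def by measurable

lemma integrable_mult_cell_atom:
  assumes "continuous_on UNIV h" "0 < \<delta>"
  shows "integrable lborel (\<lambda>x. cell_atom M \<delta> n x * h x)"
  using integrable_mult_right[OF integrable_mult_cell_diff[OF assms], of "of_real M"]
  by (simp add: cell_atom_def mult_ac)

lemma integrable_cell_atom: "0 < \<delta> \<Longrightarrow> integrable lborel (cell_atom M \<delta> n)"
  using integrable_mult_cell_atom[of "\<lambda>_. 1"] by simp

lemma norm_cell_atom_le: "0 \<le> M \<Longrightarrow> norm (cell_atom M \<delta> n x) \<le> M * 2 ^ n"
  by (simp add: cell_atom_def abs_mult abs_cell_diff_le mult_left_mono del: of_real_mult)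

text \<open>Order \<open>Suc N\<close> suffices because i + j \<le> N forces i <
  \<open>Suc N\<close>, whatever j is. The hypothesis on \<open>M\<close> compares the sup bound
  \<open>M * 2 ^ Suc N\<close> with the required power of the measure of a box of side (N +
  2)\<delta>.\<close>

lemma patom_cell_atom:
  assumes "0 < \<delta>" and M: "0 \<le> M" "M * 2 ^ Suc N \<le> (4 * ((real (Suc N) + 1) * \<delta>) ^ 3) powr (-1/p)"
  shows "patom N p (cell_atom M \<delta> (Suc N))"
  unfolding patom_def
proof (intro conjI exI allI impI)
  let ?a = "cell_atom M \<delta> (Suc N)" and ?\<rho> = "(real (Suc N) + 1) * \<delta>"
  show meas: "?a \<in> borel_measurable lebesgue"
    by (intro measurable_completion) simp
  show "bounded (range ?a)"
    unfolding bounded_iff using norm_cell_atom_le[OF M(1)] by blast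
  show "0 < ?\<rho>"
    using assms(1) by simp
  show "supp ?a \<subseteq> pbox 0 ?\<rho>"
    unfolding supp_def using cell_diff_eq_0_pbox[OF assms(1), of _ "Suc N"]
    by (intro closure_minimal) (auto simp: cell_atom_def pbox_0_eq_cbox simp del: cell_diff.simps)
  show "esssup lebesgue (\<lambda>x. ereal (norm (?a x))) \<le> ereal (measure lebesgue (pbox 0 ?\<rho>) powr (-1/p))"
  proof (rule esssup_I)
    show "(\<lambda>x. ereal (norm (?a x))) \<in> borel_measurable lebesgue"
      using meas by measurable
    show "AE x in lebesgue. ereal (norm (?a x)) \<le> ereal (measure lebesgue (pbox 0 ?\<rho>) powr (-1/p))"
      unfolding measure_pbox_0[OF less_imp_le[OF \<open>0 < ?\<rho>\<close>]] ereal_less_eq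
      using norm_cell_atom_le[OF M(1)] M(2) by (blast intro: AE_I2 order_trans)
  qed
  fix i j assume "i + j \<le> N"
  then have "(LINT x|lborel. complex_of_real (fst x ^ i * snd x ^ j) * complex_of_real (cell_diff \<delta> (Suc N) x)) = 0"
    by (intro moment_cell_diff_eq_0 assms) auto
  then have "(LINT x|lborel. complex_of_real M * (complex_of_real (fst x ^ i * snd x ^ j) * complex_of_real (cell_diff \<delta> (Suc N) x))) = 0"
    by (simp only: integral_mult_right_zero mult_zero_right)
  then have "(LINT x|lborel. complex_of_real (fst x ^ i * snd x ^ j) * ?a x) = 0"
    by (simp add: cell_atom_def mult_ac del: cell_diff.simps)
  moreover have "(\<lambda>x. complex_of_real (fst x ^ i * snd x ^ j)) \<in> borel_measurable (borel :: plane measure)"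
    by (intro borel_measurable_continuous_onI continuous_intros)
  ultimately show "(LINT x|lebesgue. complex_of_real (fst x ^ i * snd x ^ j) * ?a x) = 0"
    by (subst integral_completion)
      (auto intro!: borel_measurable_times borel_measurable_cell_atom simp del: of_real_mult of_real_power)
qed

lemma smooth_plane_imp_continuous: "smooth_plane \<psi> \<Longrightarrow> continuous_on UNIV \<psi>"
  unfolding smooth_plane_def by (drule spec[of _ 0], drule spec[of _ 0])
    (auto simp: pderivs_def intro: differentiable_imp_continuous_on)

text \<open>The function is integrable, so its pairing with \<psi> is at most its L1 norm times the
  sup norm of \<psi>, which is the one Schwartz seminorm with all indices 0.\<close>

lemma is_tempered_cell_atom:
  assumes "0 < \<delta>"
  shows "is_tempered (cell_atom M \<delta> n)"
  unfolding is_tempered_def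
proof (intro exI conjI ballI)
  let ?f = "cell_atom M \<delta> n"
  let ?T = "\<lambda>\<psi>. LINT x|lborel. ?f x * \<psi> x"
  have int: "integrable lborel (\<lambda>x. ?f x * \<psi> x)" if "\<psi> \<in> schwartz_space" for \<psi>
    using that assms by (intro integrable_mult_cell_atom smooth_plane_imp_continuous) (auto simp: schwartz_space_def)
  show "tempered_distribution ?T"
    unfolding tempered_distribution_def
  proof (intro conjI ballI allI)
    fix \<psi> \<eta> c d assume "\<psi> \<in> schwartz_space" "\<eta> \<in> schwartz_space"
    note this[THEN int]
    then have "(LINT x|lborel. c * (?f x * \<psi> x) + d * (?f x * \<eta> x)) = c * ?T \<psi> + d * ?T \<eta>"
      by simp
    then show "?T (\<lambda>x. c * \<psi> x + d * \<eta> x) = c * ?T \<psi> + d * ?T \<eta>"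
      by (simp add: algebra_simps)
  next
    show "\<exists>C M. \<forall>\<psi>\<in>schwartz_space.
        norm (?T \<psi>) \<le> C * (\<Sum>k\<le>M. \<Sum>l\<le>M. \<Sum>i\<le>M. \<Sum>j\<le>M. SUP x. schwartz_term k l i j \<psi> x)"
    proof (intro exI ballI)
      fix \<psi> assume \<psi>: "\<psi> \<in> schwartz_space"
      let ?S = "SUP x. schwartz_term 0 0 0 0 \<psi> x"
      have le: "norm (\<psi> x) \<le> ?S" for x
      proof -
        have "schwartz_term 0 0 0 0 \<psi> x \<le> ?S"
          using \<psi> by (intro cSUP_upper) (auto simp: schwartz_space_def)
        then show ?thesis
          by (simp add: schwartz_term_def pderivs_def)
      qed
      have "norm (?T \<psi>) \<le> (LINT x|lborel. norm (?f x * \<psi> x))"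
        by (rule integral_norm_bound)
      also have "\<dots> \<le> (LINT x|lborel. norm (?f x) * ?S)"
        using le
        by (intro integral_mono integrable_norm integrable_mult_left int \<psi> integrable_cell_atom assms)
          (simp add: norm_mult mult_left_mono)
      also have "\<dots> = (LINT x|lborel. norm (?f x)) * ?S"
        by simp
      finally show "norm (?T \<psi>) \<le> (LINT x|lborel. norm (?f x)) *
          (\<Sum>k\<le>0. \<Sum>l\<le>0. \<Sum>i\<le>0. \<Sum>j\<le>0. SUP x. schwartz_term k l i j \<psi> x)"
        by simp
    qed
  qed
  fix \<psi> assume "\<psi> \<in> test_functions"
  then have "integrable lborel (\<lambda>x. ?f x * \<psi> x)"
    using assms by (intro integrable_mult_cell_atom smooth_plane_imp_continuous) (auto simp: test_functions_def)
  then show "?T \<psi> = (LINT x|lebesgue. ?f x * \<psi> x)"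
    by (subst integral_completion) auto
qed

text \<open>Terms with coefficient 0 must still be atoms, so \<open>a\<close> itself is repeated.
  The partial sums equal \<open>a\<close> from n = 1 on; at n = 0 the sum is empty.\<close>

lemma atomic_rep_patom:
  assumes "patom N p a"
  shows "atomic_rep N p a (\<lambda>n. if n = 0 then 1 else 0) (\<lambda>_. a)"
  unfolding atomic_rep_def tendsto_L1loc_def
proof (intro conjI allI impI assms)
  show "summable (\<lambda>n. norm (if n = 0 then 1 else 0 :: complex) powr p)"
    by (rule summable_finite[of "{0}"]) auto
  fix K :: "plane set"
  have "(LINT x:K|lebesgue. norm ((\<Sum>k<n. (if k = 0 then 1 else 0) * a x) - a x)) = 0" if "0 < n" for n :: nat
  proof -
    have "(\<Sum>k<n. (if k = 0 then 1 else 0) * a x) = a x" for x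
      using that by (subst sum.remove[of _ 0]) auto
    then show ?thesis
      by (simp add: set_lebesgue_integral_def)
  qed
  then show "(\<lambda>n. LINT x:K|lebesgue. norm ((\<Sum>k<n. (if k = 0 then 1 else 0) * a x) - a x)) \<longlonglongrightarrow> 0"
    by (intro tendsto_eventually eventually_sequentiallyI[of 1]) auto
qed

lemma Hpar_norm_patom_le:
  assumes "patom N p a" "0 < p"
  shows "Hpar_norm N p a \<le> 1"
proof -
  let ?X = "{(\<Sum>n. norm (c n) powr p) | c b. atomic_rep N p a c b}"
  have nonneg: "0 \<le> y" if "y \<in> ?X" for y
    using that by (auto simp: atomic_rep_def intro: suminf_nonneg)
  have "(\<Sum>n. norm (if n = 0 then 1 else 0 :: complex) powr p) = (\<Sum>n\<in>{0::nat}. norm (if n = 0 then 1 else 0 :: complex) powr p)"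
    by (rule suminf_finite) auto
  then have "1 \<in> ?X"
    using atomic_rep_patom[OF assms(1)] by force
  \<comment> \<open>The one-term representation bounds the infimum above. The lower bound 0 is
    needed for the real \<open>Inf\<close> to be a true infimum and for monotonicity of
    \<open>powr\<close>.\<close>
  then have "Inf ?X \<le> 1" "0 \<le> Inf ?X"
    using nonneg by (auto intro!: cInf_lower cInf_greatest bdd_belowI[of _ 0])
  then show ?thesis
    unfolding Hpar_norm_def using assms(2) powr_mono2[of "1/p" "Inf ?X" 1] by simp
qed

lemma cell_atom_in_Hpar:
  assumes "0 < \<delta>" "patom N p (cell_atom M \<delta> n)"
  shows "cell_atom M \<delta> n \<in> Hpar N p"
proof -
  have int: "integrable lebesgue (cell_atom M \<delta> n)"
    using integrable_cell_atom[OF assms(1)] by (subst integrable_completion) auto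
  then have "cell_atom M \<delta> n \<in> L1loc"
    unfolding L1loc_def set_integrable_def
    by (auto intro!: integrable_mult_indicator borel_measurable_integrable lmeasurable_compact fmeasurableD)
  then show ?thesis
    unfolding Hpar_def using is_tempered_cell_atom[OF assms(1)] atomic_rep_patom[OF assms(2)] by blast
qed

section \<open>Lower bound for the average near the parabola\<close>

lemma bump_continuous: "bump \<phi> \<Longrightarrow> continuous_on UNIV \<phi>"
  unfolding bump_def by (elim conjE, drule spec[of _ 0]) (auto intro: differentiable_imp_continuous_on)

lemma bump_eq_0: "bump \<phi> \<Longrightarrow> t \<le> 1/2 \<Longrightarrow> \<phi> t = 0"
  unfolding bump_def supp_def using closure_subset[of "{t. \<phi> t \<noteq> 0}"] by fastforce

lemma bump_eq_1: "bump \<phi> \<Longrightarrow> 1 < t \<Longrightarrow> t < 2 \<Longrightarrow> \<phi> t = 1"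
  unfolding bump_def by simp

text \<open>The integrand is jointly Borel, so the integral over t is Borel in x. Superlevel sets of
  the average can then be compared by \<open>emeasure_mono\<close>.\<close>

lemma borel_measurable_avg_op:
  assumes [measurable]: "f \<in> borel_measurable borel" "\<phi> \<in> borel_measurable borel"
  shows "avg_op \<phi> f \<in> borel_measurable borel"
proof -
  have [measurable]: "f \<in> borel_measurable (borel \<Otimes>\<^sub>M borel)"
    unfolding borel_prod by fact
  have "avg_op \<phi> f = (\<lambda>x. LINT t|lborel. f (fst x - t, snd x - t\<^sup>2) * complex_of_real (\<phi> t))"
    unfolding avg_op_def by (intro ext integral_completion) measurable
  also have "\<dots> \<in> borel_measurable (borel \<Otimes>\<^sub>M borel)"
    by measurable
  finally show ?thesis
    unfolding borel_prod .
qed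

text \<open>In the factorisation of y - t^2 the factor t + \<open>sqrt y\<close> is at least 1. This
  confines the curve parameter to a neighbourhood of its crossing point.\<close>

lemma abs_diff_sqrt_le:
  assumes "1 \<le> y" "1/2 \<le> t" "\<bar>y - t\<^sup>2\<bar> \<le> e"
  shows "\<bar>t - sqrt y\<bar> \<le> e"
proof -
  have "1 \<le> sqrt y"
    using assms(1) by simp
  have "\<bar>y - t\<^sup>2\<bar> = \<bar>(t - sqrt y) * (t + sqrt y)\<bar>"
    using assms(1) by (simp add: algebra_simps power2_eq_square abs_minus_commute)
  also have "\<dots> = \<bar>t - sqrt y\<bar> * (t + sqrt y)"
    using assms(2) \<open>1 \<le> sqrt y\<close> by (simp add: abs_mult)
  also have "\<dots> \<ge> \<bar>t - sqrt y\<bar> * 1"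
    using assms(2) \<open>1 \<le> sqrt y\<close> by (intro mult_left_mono) linarith+
  finally show ?thesis
    using assms(3) by simp
qed

text \<open>The curve x - (t, t^2) is in the row of cells only for t within \<delta>^2 \<le>
  \<delta>/4 of s = \<open>sqrt (snd x)\<close>. For such t, \<open>fst x - t\<close> lies between 0
  and 3\<delta>/4, hence in the first cell: nothing cancels, and the average is \<open>M\<close>
  times the time spent in the row.\<close>

lemma norm_avg_op_cell_atom_ge:
  assumes \<phi>: "bump \<phi>" and \<delta>: "0 < \<delta>" "\<delta> \<le> 1/4" and "0 \<le> M"
    and x2: "2 \<le> snd x" "snd x \<le> 3"
    and x1: "\<delta>/4 \<le> fst x - sqrt (snd x)" "fst x - sqrt (snd x) \<le> \<delta>/2"
  shows "M * \<delta>\<^sup>2 / 2 \<le> norm (avg_op \<phi> (cell_atom M \<delta> n) x)"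
proof -
  \<comment> \<open>The cut at 1/2 discards the negative root; it loses nothing, since \<phi>
    vanishes up to 1/2.\<close>
  define S where "S = {1/2..} \<inter> {t. \<bar>snd x - t\<^sup>2\<bar> \<le> \<delta>\<^sup>2}"
  define s where "s = sqrt (snd x)"
  have s2: "s\<^sup>2 = snd x"
    using x2 by (simp add: s_def)
  \<comment> \<open>A margin of 1/4 inside (1, 2), where \<phi> = 1, absorbs the deviation
    \<delta>^2 \<le> 1/16 of t from s.\<close>
  have s: "5/4 \<le> s" "s \<le> 7/4"
    unfolding s_def using x2 by (auto intro!: real_le_rsqrt real_le_lsqrt simp: power2_eq_square simp del: divide_le_eq_numeral1 le_divide_eq_numeral1)
  have "\<delta>\<^sup>2 \<le> \<delta>/4"
    using \<delta> by (simp add: power2_eq_square)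
  have S: "\<bar>t - s\<bar> \<le> \<delta>\<^sup>2" if "t \<in> S" for t
    using that abs_diff_sqrt_le[of "snd x" t "\<delta>\<^sup>2"] x2 by (auto simp: S_def s_def)
  have "cell_atom M \<delta> n (fst x - t, snd x - t\<^sup>2) * complex_of_real (\<phi> t) = complex_of_real (M * indicator S t)" for t
  proof (cases "t \<in> S")
    case True
    with S[OF True] have "cell_diff \<delta> n (fst x - t, snd x - t\<^sup>2) = 1"
      using \<delta> x1 \<open>\<delta>\<^sup>2 \<le> \<delta>/4\<close> by (intro cell_diff_eq_1) (auto simp: S_def s_def)
    moreover have "\<phi> t = 1"
      using S[OF True] s \<delta> \<open>\<delta>\<^sup>2 \<le> \<delta>/4\<close> by (intro bump_eq_1[OF \<phi>]) auto
    ultimately show ?thesis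
      using True by (simp add: cell_atom_def)
  next
    case False
    then have "\<phi> t = 0 \<or> cell_diff \<delta> n (fst x - t, snd x - t\<^sup>2) = 0"
      using bump_eq_0[OF \<phi>, of t] cell_diff_eq_0_strip[of \<delta> "(fst x - t, snd x - t\<^sup>2)" n]
      by (auto simp: S_def)
    with False show ?thesis
      by (auto simp: cell_atom_def)
  qed
  then have "avg_op \<phi> (cell_atom M \<delta> n) x = (LINT t|lebesgue. complex_of_real (M * indicator S t))"
    unfolding avg_op_def by simp
  also have "\<dots> = complex_of_real (M * measure lebesgue S)"
    by (subst integral_complex_of_real) simp
  finally have eq: "norm (avg_op \<phi> (cell_atom M \<delta> n) x) = M * measure lebesgue S"
    using \<open>0 \<le> M\<close> by (simp add: norm_mult del: of_real_mult)
  have "closed S"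
    unfolding S_def by (intro closed_Int closed_atLeast closed_Collect_le continuous_intros)
  moreover have "S \<subseteq> cball s (\<delta>\<^sup>2)"
    using S by (auto simp: dist_real_def abs_minus_commute)
  ultimately have "S \<in> lmeasurable"
    by (intro lmeasurable_compact) (auto simp: compact_eq_bounded_closed intro: bounded_subset)
  \<comment> \<open>Since t + s \<le> 4, a radius of \<delta>^2/4 around s keeps t^2 within
    \<delta>^2 of s^2. The interval has length \<delta>^2/2, the constant in the claim.\<close>
  moreover have "{s - \<delta>\<^sup>2/4 .. s + \<delta>\<^sup>2/4} \<subseteq> S"
  proof
    fix t assume t: "t \<in> {s - \<delta>\<^sup>2/4 .. s + \<delta>\<^sup>2/4}"
    have "t \<ge> 1/2" "t + s \<le> 4"
      using t s \<delta> \<open>\<delta>\<^sup>2 \<le> \<delta>/4\<close> by auto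
    have "\<bar>snd x - t\<^sup>2\<bar> = \<bar>(t - s) * (t + s)\<bar>"
      unfolding s2[symmetric] by (simp add: algebra_simps power2_eq_square abs_minus_commute)
    also have "\<dots> = \<bar>t - s\<bar> * (t + s)"
      using \<open>t \<ge> 1/2\<close> s by (simp add: abs_mult)
    also have "\<dots> \<le> \<delta>\<^sup>2/4 * 4"
    proof (rule mult_mono)
      show "\<bar>t - s\<bar> \<le> \<delta>\<^sup>2/4"
        using t by (simp only: abs_le_iff atLeastAtMost_iff) linarith
    qed (use \<open>t \<ge> 1/2\<close> s \<open>t + s \<le> 4\<close> in auto)
    finally show "t \<in> S"
      using \<open>t \<ge> 1/2\<close> by (simp add: S_def)
  qed
  ultimately have "measure lebesgue {s - \<delta>\<^sup>2/4 .. s + \<delta>\<^sup>2/4} \<le> measure lebesgue S"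
    by (intro measure_mono_fmeasurable) auto
  then have "\<delta>\<^sup>2 / 2 \<le> measure lebesgue S"
    by simp
  then show ?thesis
    unfolding eq using mult_left_mono[OF _ \<open>0 \<le> M\<close>, of "\<delta>\<^sup>2 / 2"] by simp
qed

section \<open>Area of the strip and the weak quasinorm\<close>

text \<open>By Tonelli: the slice at each height y in [2, 3] is an interval of length e, moved by
  \<open>sqrt y\<close>, and the heights fill an interval of length 1.\<close>

lemma emeasure_sqrt_strip:
  assumes "0 \<le> e"
  shows "{x::plane. snd x \<in> {2..3} \<and> fst x - sqrt (snd x) \<in> {e..2*e}} \<in> sets borel"
    and "emeasure lborel {x::plane. snd x \<in> {2..3} \<and> fst x - sqrt (snd x) \<in> {e..2*e}} = ennreal e"
proof -
  let ?E = "{x::plane. snd x \<in> {2..3} \<and> fst x - sqrt (snd x) \<in> {e..2*e}}"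
  have "?E = {x. 2 \<le> snd x} \<inter> {x. snd x \<le> 3} \<inter> {x. e \<le> fst x - sqrt (snd x)} \<inter> {x. fst x - sqrt (snd x) \<le> 2 * e}"
    by auto
  then show E: "?E \<in> sets borel"
    by (auto intro!: borel_closed closed_Int closed_Collect_le continuous_intros)
  have "emeasure lborel ?E = emeasure (lborel \<Otimes>\<^sub>M lborel) ?E"
    by (simp only: lborel_prod)
  also have "\<dots> = (\<integral>\<^sup>+y. emeasure lborel ((\<lambda>x. (x, y)) -` ?E) \<partial>lborel)"
    using E by (subst lborel_pair.emeasure_pair_measure_alt2) (simp_all only: lborel_prod sets_lborel)
  also have "\<dots> = (\<integral>\<^sup>+y. ennreal e * indicator {2..3::real} y \<partial>lborel)"
  proof (intro nn_integral_cong)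
    fix y :: real
    have "(\<lambda>x. (x, y)) -` ?E = (if y \<in> {2..3} then {sqrt y + e..sqrt y + 2*e} else {})"
      by auto
    then show "emeasure lborel ((\<lambda>x. (x, y)) -` ?E) = ennreal e * indicator {2..3} y"
      using assms by simp
  qed
  also have "\<dots> = ennreal e"
    by (simp add: nn_integral_cmult_indicator)
  finally show "emeasure lborel ?E = ennreal e" .
qed

lemma ennreal_powr_ge:
  assumes "ennreal a \<le> y" "0 \<le> a" "0 \<le> s"
  shows "ennreal (a powr s) \<le> ennreal_powr y s"
  using assms by (cases y) (auto simp: ennreal_powr_def intro!: ennreal_leI powr_mono2)

lemma weak_Lp_norm_cell_atom_ge:
  assumes "bump \<phi>" "0 < \<delta>" "\<delta> \<le> 1/4" "0 < M" "0 < p"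
  shows "ennreal (M * \<delta>\<^sup>2 / 4 * (\<delta>/4) powr (1/p)) \<le> weak_Lp_norm p (avg_op \<phi> (cell_atom M \<delta> n))"
proof -
  \<comment> \<open>The level is half the pointwise lower bound, because superlevel sets are defined
    by a strict inequality.\<close>
  let ?g = "avg_op \<phi> (cell_atom M \<delta> n)" and ?\<alpha> = "M * \<delta>\<^sup>2 / 4"
  let ?E = "{x::plane. snd x \<in> {2..3} \<and> fst x - sqrt (snd x) \<in> {\<delta>/4..2*(\<delta>/4)}}"
  have [measurable]: "?g \<in> borel_measurable borel"
    by (intro borel_measurable_avg_op borel_measurable_cell_atom
        borel_measurable_continuous_onI bump_continuous assms)
  have "?\<alpha> < M * \<delta>\<^sup>2 / 2" "0 < ?\<alpha>"
    using assms by simp_all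
  have "?E \<subseteq> {x. norm (?g x) > ?\<alpha>}"
  proof
    fix x assume "x \<in> ?E"
    then have "M * \<delta>\<^sup>2 / 2 \<le> norm (?g x)"
      using assms by (intro norm_avg_op_cell_atom_ge) auto
    with \<open>?\<alpha> < M * \<delta>\<^sup>2 / 2\<close> show "x \<in> {x. norm (?g x) > ?\<alpha>}"
      by simp
  qed
  moreover have sets: "{x. norm (?g x) > ?\<alpha>} \<in> sets lborel"
    by measurable
  ultimately have "emeasure lborel ?E \<le> emeasure lborel {x. norm (?g x) > ?\<alpha>}"
    by (rule emeasure_mono)
  then have "ennreal (\<delta>/4) \<le> emeasure lborel {x. norm (?g x) > ?\<alpha>}"
    using assms(2) by (subst (asm) emeasure_sqrt_strip) auto
  also have "emeasure lborel {x. norm (?g x) > ?\<alpha>} = emeasure lebesgue {x. norm (?g x) > ?\<alpha>}"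
    using sets by simp
  finally have "ennreal ((\<delta>/4) powr (1/p)) \<le> ennreal_powr (emeasure lebesgue {x. norm (?g x) > ?\<alpha>}) (1/p)"
    using assms by (intro ennreal_powr_ge) auto
  then have "ennreal ?\<alpha> * ennreal ((\<delta>/4) powr (1/p)) \<le>
      ennreal ?\<alpha> * ennreal_powr (emeasure lebesgue {x. norm (?g x) > ?\<alpha>}) (1/p)"
    by (rule mult_left_mono) simp
  also have "\<dots> \<le> weak_Lp_norm p ?g"
    unfolding weak_Lp_norm_def using \<open>0 < ?\<alpha>\<close> by (intro SUP_upper) simp
  finally show ?thesis
    using \<open>0 < ?\<alpha>\<close> by (simp only: ennreal_mult'[OF less_imp_le])
qed

section \<open>Blow-up as the scale tends to 0\<close>

theorem theorem1p7:
  fixes \<phi> :: "real \<Rightarrow> real" and p :: real and N :: nat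
  assumes "bump \<phi>"
    and "0 < p" and "p < 1"
    and "0 < N" and "\<lfloor>3 * (1/p - 1)\<rfloor> \<le> int N"
  shows "\<not> (\<exists>C::real. \<forall>f\<in>Hpar N p.
           weak_Lp_norm p (avg_op \<phi> f) \<le> ennreal (C * Hpar_norm N p f))"
proof
  assume "\<exists>C::real. \<forall>f\<in>Hpar N p. weak_Lp_norm p (avg_op \<phi> f) \<le> ennreal (C * Hpar_norm N p f)"
  then obtain C where C: "\<And>f. f \<in> Hpar N p \<Longrightarrow> weak_Lp_norm p (avg_op \<phi> f) \<le> ennreal (C * Hpar_norm N p f)"
    by blast
  \<comment> \<open>\<open>R * \<delta> ^ 3\<close> is the measure of the box containing the atom;
    \<open>K\<close> collects all factors of the lower bound that do not depend on \<delta>.\<close>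
  define R where "R = 4 * (real (Suc N) + 1) ^ 3"
  define K where "K = R powr (-1/p) / 2 ^ Suc N / 4 * (1/4) powr (1/p)"
  have "0 < R"
    by (simp add: R_def)
  then have "0 < K"
    by (simp add: K_def)
  have bound: "K \<le> \<bar>C\<bar> * \<delta> powr (2/p - 2)" if \<delta>: "0 < \<delta>" "\<delta> \<le> 1/4" for \<delta>
  proof -
    \<comment> \<open>The largest amplitude that \<open>patom_cell_atom\<close> admits.\<close>
    define M where "M = (R * \<delta> ^ 3) powr (-1/p) / 2 ^ Suc N"
    let ?a = "cell_atom M \<delta> (Suc N)"
    have "0 < M"
      using \<delta> \<open>0 < R\<close> by (simp add: M_def)
    have atom: "patom N p ?a"
      using \<delta> \<open>0 < M\<close> by (intro patom_cell_atom) (auto simp: M_def R_def power_mult_distrib mult_ac)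
    have "ennreal (M * \<delta>\<^sup>2 / 4 * (\<delta>/4) powr (1/p)) \<le> weak_Lp_norm p (avg_op \<phi> ?a)"
      using assms \<delta> \<open>0 < M\<close> by (intro weak_Lp_norm_cell_atom_ge)
    also have "\<dots> \<le> ennreal (C * Hpar_norm N p ?a)"
      using cell_atom_in_Hpar[OF \<delta>(1) atom] by (rule C)
    \<comment> \<open>\<open>C\<close> may be negative, so it is replaced by its absolute value
      before the quasinorm is bounded by 1.\<close>
    also have "\<dots> \<le> ennreal (\<bar>C\<bar> * 1)"
    proof (intro ennreal_leI order_trans[OF mult_right_mono mult_left_mono])
      show "0 \<le> Hpar_norm N p ?a"
        by (simp add: Hpar_norm_def)
    qed (use Hpar_norm_patom_le[OF atom assms(2)] in auto)
    finally have le: "M * \<delta>\<^sup>2 / 4 * (\<delta>/4) powr (1/p) \<le> \<bar>C\<bar>"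
      by (simp add: ennreal_le_iff)
    \<comment> \<open>The three factors come from the amplitude, the time spent in the cell, and the
      area of the strip.\<close>
    have "\<delta> powr (2 - 2/p) = \<delta> powr (3 * (-1/p)) * \<delta> powr 2 * \<delta> powr (1/p)"
      unfolding powr_add[symmetric] by (rule arg_cong[of _ _ "(powr) \<delta>"]) (simp add: field_simps)
    also have "\<delta> powr (3 * (-1/p)) = (\<delta> ^ 3) powr (-1/p)"
      using \<delta> powr_powr[of \<delta> 3 "-1/p"] by (simp add: powr_numeral)
    finally have "M * \<delta>\<^sup>2 / 4 * (\<delta>/4) powr (1/p) = K * \<delta> powr (2 - 2/p)"
      using \<delta> \<open>0 < R\<close> by (simp add: M_def K_def powr_mult powr_divide powr_numeral)
    with le have "K * \<delta> powr (2 - 2/p) * \<delta> powr (2/p - 2) \<le> \<bar>C\<bar> * \<delta> powr (2/p - 2)"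
      by (intro mult_right_mono) auto
    then show ?thesis
      using \<delta> by (simp add: mult.assoc powr_add[symmetric])
  qed
  \<comment> \<open>Here p < 1 enters: the exponent is positive, so the right side of
    \<open>bound\<close> tends to 0 while \<open>K\<close> stays fixed.\<close>
  have "2/p - 2 > 0"
    using assms by (simp add: field_simps)
  then have "((\<lambda>\<delta>. \<bar>C\<bar> * \<delta> powr (2/p - 2)) \<longlongrightarrow> \<bar>C\<bar> * 0) (at_right 0)"
    by (intro tendsto_mult tendsto_const tendsto_zero_powrI[OF _ tendsto_const])
      (auto intro: tendsto_ident_at eventually_at_rightI[of 0 1])
  moreover have "eventually (\<lambda>\<delta>. K \<le> \<bar>C\<bar> * \<delta> powr (2/p - 2)) (at_right 0)"
    unfolding eventually_at_right_field using bound by (intro exI[of _ "1/4"]) auto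
  ultimately have "K \<le> \<bar>C\<bar> * 0"
    by (intro tendsto_lowerbound) auto
  with \<open>0 < K\<close> show False
    by simp
qed

end
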